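(* The sublevel sets $\Sigma^{\le k}_{\mathcal D}(n,m)$ are not always strongly connected, even if the data points are in general position. More specifically: there exist $d,n,m\ge1$, a finite data set $\mathcal D\subset\mathbb R^d$ in general position, a target dichotomy $C^*\in\{+,-\}^{|\mathcal D|}$ and $k\ge0$ such that $\Sigma^{\le k}_{\mathcal D}(n,m)$ is not strongly connected, and such that there is a strongly connected component $C$ of the level set $\Sigma^k_{\mathcal D}(n,m)$ for which all neighbors $D\in\Sigma_{\mathcal D}(n,m)$ of $C$ (i.e. full-dimensional cones $D$ not in $C$ which are adjacent to a full-dimensional cone of $C$ through codimension $1$) satisfy $\operatorname{err}_{C^*}(D)>k$.
   Context: $\Theta(d,n,m)\cong\mathbb R^{(n+m)(d+1)}$ is the space of parameters $\theta=(a_1,\mathbf s_1,\dots,a_n,\mathbf s_n,b_1,\mathbf t_1,\dots,b_m,\mathbf t_m)$; put $a_{n+j}=b_j$, $\mathbf s_{n+j}=\mathbf t_j$ for $j\in[m]$, so $[n+m]=[n]\sqcup[m]$, and $f_\theta(\mathbf x)=\max_{i\in[n]}(a_i+\langle\mathbf s_i,\mathbf x\rangle)-\max_{j\in[m]}(b_j+\langle\mathbf t_j,\mathbf x\rangle)$. The activation pattern of $\theta$ is the bipartite graph on $\mathcal D\sqcup([n]\sqcup[m])$ in which $\mathbf p$ is joined to exactly those indices $l$ with $a_l+\langle\mathbf s_l,\mathbf p\rangle=\max_{l'\in[n]\sqcup[m]}(a_{l'}+\langle\mathbf s_{l'},\mathbf p\rangle)$. The activation cone $C_{\mathcal D}(G)$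 is the Euclidean closure of the set of $\theta$ with activation pattern $G$; the classification fan $\Sigma_{\mathcal D}(n,m)$ is the set of all (nonempty) activation cones, a complete polyhedral fan. With $\mathcal D=\{\mathbf p_1,\dots,\mathbf p_M\}$, the $0/1$-loss is $\operatorname{err}_{C^*}(\theta)=|\{i\in[M]\mid\operatorname{sgn}(f_\theta(\mathbf p_i))=-C^*_i\}|$. It is constant on the set of $\theta$ with a given activation pattern $G$; $\operatorname{err}_{C^*}(G)=\operatorname{err}_{C^*}(C_{\mathcal D}(G))$ denotes this value. The $k$-th level set $\Sigma^k_{\mathcal D}(n,m)$ is the collection of activation cones $C_{\mathcal D}(G)$ with $\operatorname{err}_{C^*}(G)=k$, and the sublevel set is $\Sigma^{\le k}_{\mathcal D}(n,m)=\bigcup_{k'=0}^k\Sigma^{k'}_{\mathcal D}(n,m)$. Two full-dimensional cones are adjacent through codimension $1$ if their intersection has codimension $1$ in $\Theta(d,n,m)$. A collection of cones is strongly connected if any two of its full-dimensional cones are joined by a sequence of full-dimensional cones of the collection in which consecutive cones are adjacent through codimension $1$; the strongly connected components are the inclusion-maximal strongly connected subcollections (of full-dimensional cones). General position: no $d+1$ distinct points of $\mathcal D$ lie on a common affine hyperplane. *)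

theory Defs
  imports "HOL-Analysis.Analysis" "HOL-Library.Function_Algebras"
begin

text \<open>
  The dimension \<open>d\<close> and the numbers \<open>n\<close>, \<open>m\<close> of terms are existentially quantified, so
  \<open>\<real>\<^sup>d\<close> and the parameter space are subsets of types of functions on \<open>nat\<close>.
  The product topology and the pointwise vector space structure of these function types
  induce the usual Euclidean structures on the finite-dimensional subspaces used below.
\<close>

instantiation "fun" :: (type, real_vector) real_vector
begin

definition scaleR_fun :: "real \<Rightarrow> ('a \<Rightarrow> 'b) \<Rightarrow> 'a \<Rightarrow> 'b" where
  "scaleR_fun c f = (\<lambda>x. c *\<^sub>R f x)"

instance
  by standard (auto simp: scaleR_fun_def plus_fun_def fun_eq_iff scaleR_add_left scaleR_add_right)

end

type_synonym point = "nat \<Rightarrow> real"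

definition real_space :: "nat \<Rightarrow> point set" where
  "real_space d = {x. \<forall>i\<ge>d. x i = 0}"

definition general_position :: "nat \<Rightarrow> point set \<Rightarrow> bool" where
  "general_position d D \<longleftrightarrow>
     (\<forall>S. S \<subseteq> D \<and> card S = d + 1 \<longrightarrow>
        \<not> (\<exists>u b. u \<in> real_space d \<and> u \<noteq> 0 \<and> (\<forall>x\<in>S. (\<Sum>i<d. u i * x i) = b)))"

text \<open>
  A parameter is a pair \<open>(a, s)\<close> of constant terms \<open>a l\<close> and slopes \<open>s l\<close>. The indices
  \<open>l < n\<close> form the block \<open>[n]\<close> and the indices \<open>n \<le> l < n + m\<close> the block \<open>[m]\<close>,
  that is, \<open>b\<^sub>j = a (n + j)\<close> and \<open>t\<^sub>j = s (n + j)\<close> (counting from \<open>0\<close>).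
\<close>

type_synonym param = "(nat \<Rightarrow> real) \<times> (nat \<Rightarrow> point)"

definition param_space :: "nat \<Rightarrow> nat \<Rightarrow> nat \<Rightarrow> param set" where
  "param_space d n m =
     {(a, s). (\<forall>l\<ge>n + m. a l = 0 \<and> s l = 0) \<and> (\<forall>l<n + m. s l \<in> real_space d)}"

definition affine_term :: "nat \<Rightarrow> param \<Rightarrow> nat \<Rightarrow> point \<Rightarrow> real" where
  "affine_term d \<theta> l x = fst \<theta> l + (\<Sum>i<d. snd \<theta> l i * x i)"

definition tropical_rational :: "nat \<Rightarrow> nat \<Rightarrow> nat \<Rightarrow> param \<Rightarrow> point \<Rightarrow> real" where
  "tropical_rational d n m \<theta> x =
     (MAX l\<in>{..<n}. affine_term d \<theta> l x) - (MAX l\<in>{n..<n + m}. affine_term d \<theta> l x)"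

text \<open>The bipartite graph on \<open>D \<squnion> ([n] \<squnion> [m])\<close> is represented by its set of edges.\<close>

definition activation_pattern ::
    "nat \<Rightarrow> nat \<Rightarrow> nat \<Rightarrow> point set \<Rightarrow> param \<Rightarrow> (point \<times> nat) set" where
  "activation_pattern d n m D \<theta> =
     {(p, l). p \<in> D \<and> l < n + m \<and>
        affine_term d \<theta> l p = (MAX l'\<in>{..<n + m}. affine_term d \<theta> l' p)}"

definition activation_cone ::
    "nat \<Rightarrow> nat \<Rightarrow> nat \<Rightarrow> point set \<Rightarrow> (point \<times> nat) set \<Rightarrow> param set" where
  "activation_cone d n m D G =
     closure {\<theta> \<in> param_space d n m. activation_pattern d n m D \<theta> = G}"

definition classification_fan :: "nat \<Rightarrow> nat \<Rightarrow> nat \<Rightarrow> point set \<Rightarrow> param set set" where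
  "classification_fan d n m D =
     {activation_cone d n m D G | G. G \<subseteq> D \<times> {..<n + m} \<and> activation_cone d n m D G \<noteq> {}}"

text \<open>A dichotomy is a labelling \<open>C\<close> of the data points by \<open>1\<close> and \<open>-1\<close>.\<close>

definition dichotomy :: "point set \<Rightarrow> (point \<Rightarrow> real) \<Rightarrow> bool" where
  "dichotomy D C \<longleftrightarrow> (\<forall>p\<in>D. C p = 1 \<or> C p = -1)"

definition err :: "nat \<Rightarrow> nat \<Rightarrow> nat \<Rightarrow> point set \<Rightarrow> (point \<Rightarrow> real) \<Rightarrow> param \<Rightarrow> nat" where
  "err d n m D C \<theta> = card {p \<in> D. sgn (tropical_rational d n m \<theta> p) = - C p}"

text \<open>
  The common loss of the parameters whose activation pattern spans the cone \<open>K\<close>; it is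
  well-defined on the cones of the fan by \<open>err_cone_eq\<close> below.
\<close>

definition err_cone ::
    "nat \<Rightarrow> nat \<Rightarrow> nat \<Rightarrow> point set \<Rightarrow> (point \<Rightarrow> real) \<Rightarrow> param set \<Rightarrow> nat" where
  "err_cone d n m D C K =
     (THE e. \<exists>\<theta>\<in>param_space d n m.
        activation_cone d n m D (activation_pattern d n m D \<theta>) = K \<and> err d n m D C \<theta> = e)"

definition level_set ::
    "nat \<Rightarrow> nat \<Rightarrow> nat \<Rightarrow> point set \<Rightarrow> (point \<Rightarrow> real) \<Rightarrow> nat \<Rightarrow> param set set" where
  "level_set d n m D C k = {K \<in> classification_fan d n m D. err_cone d n m D C K = k}"

definition sublevel_set ::
    "nat \<Rightarrow> nat \<Rightarrow> nat \<Rightarrow> point set \<Rightarrow> (point \<Rightarrow> real) \<Rightarrow> nat \<Rightarrow> param set set" where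
  "sublevel_set d n m D C k = (\<Union>k'\<le>k. level_set d n m D C k')"

text \<open>
  All cones of the fan contain the origin, so the dimension of a cone, or of an intersection
  of cones, is the dimension \<^const>\<open>dim\<close> of its linear span.
\<close>

definition full_dimensional :: "nat \<Rightarrow> nat \<Rightarrow> nat \<Rightarrow> param set \<Rightarrow> bool" where
  "full_dimensional d n m K \<longleftrightarrow> dim K = dim (param_space d n m)"

definition adjacent :: "nat \<Rightarrow> nat \<Rightarrow> nat \<Rightarrow> param set \<Rightarrow> param set \<Rightarrow> bool" where
  "adjacent d n m K L \<longleftrightarrow>
     full_dimensional d n m K \<and> full_dimensional d n m L \<and>
     dim (K \<inter> L) + 1 = dim (param_space d n m)"

definition strongly_connected :: "nat \<Rightarrow> nat \<Rightarrow> nat \<Rightarrow> param set set \<Rightarrow> bool" where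
  "strongly_connected d n m S \<longleftrightarrow>
     (\<forall>K\<in>S. \<forall>L\<in>S. full_dimensional d n m K \<and> full_dimensional d n m L \<longrightarrow>
        (\<lambda>K' L'. K' \<in> S \<and> L' \<in> S \<and> adjacent d n m K' L')\<^sup>*\<^sup>* K L)"

text \<open>Components are nonempty, so a collection without full-dimensional cones has none.\<close>

definition strong_components :: "nat \<Rightarrow> nat \<Rightarrow> nat \<Rightarrow> param set set \<Rightarrow> param set set set" where
  "strong_components d n m S =
     {T. T \<noteq> {} \<and> T \<subseteq> {K \<in> S. full_dimensional d n m K} \<and> strongly_connected d n m T \<and>
         (\<forall>T'. T \<subseteq> T' \<and> T' \<subseteq> {K \<in> S. full_dimensional d n m K} \<and> strongly_connected d n m T'
            \<longrightarrow> T' = T)}"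

definition neighbors ::
    "nat \<Rightarrow> nat \<Rightarrow> nat \<Rightarrow> point set \<Rightarrow> param set set \<Rightarrow> param set set" where
  "neighbors d n m D T =
     {L \<in> classification_fan d n m D. L \<notin> T \<and> (\<exists>K\<in>T. adjacent d n m K L)}"

lemma mem_activation_pattern_iff:
  "(p, l) \<in> activation_pattern d n m D \<theta> \<longleftrightarrow>
     p \<in> D \<and> l < n + m \<and> (\<forall>l'<n + m. affine_term d \<theta> l' p \<le> affine_term d \<theta> l p)"
proof (cases "l < n + m")
  case True
  let ?V = "(\<lambda>l'. affine_term d \<theta> l' p) ` {..<n + m}"
  have V: "finite ?V" "?V \<noteq> {}" using True by auto
  have mem: "affine_term d \<theta> l p \<in> ?V" using True by blast
  have "affine_term d \<theta> l p = Max ?V \<longleftrightarrow> (\<forall>v\<in>?V. v \<le> affine_term d \<theta> l p)"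
    using V mem by (metis Max_ge Max_eqI)
  then show ?thesis using True by (auto simp: activation_pattern_def)
qed (auto simp: activation_pattern_def)

lemma tropical_rational_le_iff:
  assumes "n \<ge> 1" "m \<ge> 1" "p \<in> D"
  shows "tropical_rational d n m \<theta> p \<le> 0 \<longleftrightarrow>
           (\<exists>l\<in>{n..<n + m}. (p, l) \<in> activation_pattern d n m D \<theta>)" (is ?A)
    and "tropical_rational d n m \<theta> p \<ge> 0 \<longleftrightarrow>
           (\<exists>l\<in>{..<n}. (p, l) \<in> activation_pattern d n m D \<theta>)" (is ?B)
proof -
  let ?v = "\<lambda>l. affine_term d \<theta> l p"
  let ?M = "Max (?v ` {..<n})" and ?N = "Max (?v ` {n..<n + m})"
  have "?M \<in> ?v ` {..<n}" using assms by (intro Max_in) (auto simp: lessThan_empty_iff)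
  then obtain i where i: "i < n" "?M = ?v i" by auto
  have "?N \<in> ?v ` {n..<n + m}" using assms by (intro Max_in) auto
  then obtain j where j: "n \<le> j" "j < n + m" "?N = ?v j" by auto
  have M: "?v l \<le> ?v i" if "l < n" for l using that i(2) by (metis Max_ge finite_imageI finite_lessThan imageI lessThan_iff)
  have N: "?v l \<le> ?v j" if "n \<le> l" "l < n + m" for l
    using that j(3) by (metis Max_ge finite_imageI finite_atLeastLessThan imageI atLeastLessThan_iff)
  have f: "tropical_rational d n m \<theta> p = ?v i - ?v j"
    using i j by (simp add: tropical_rational_def)
  show ?A
  proof
    assume "tropical_rational d n m \<theta> p \<le> 0"
    then have "?v l \<le> ?v j" if "l < n + m" for l
      using M[of l] N[of l] that f by (cases "l < n") auto
    then show "\<exists>l\<in>{n..<n + m}. (p, l) \<in> activation_pattern d n m D \<theta>"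
      using j assms by (intro bexI[of _ j]) (auto simp: mem_activation_pattern_iff)
  next
    assume "\<exists>l\<in>{n..<n + m}. (p, l) \<in> activation_pattern d n m D \<theta>"
    then obtain l where "n \<le> l" "l < n + m" "?v i \<le> ?v l"
      using i by (auto simp: mem_activation_pattern_iff)
    with N[of l] f show "tropical_rational d n m \<theta> p \<le> 0" by auto
  qed
  show ?B
  proof
    assume "tropical_rational d n m \<theta> p \<ge> 0"
    then have "?v l \<le> ?v i" if "l < n + m" for l
      using M[of l] N[of l] that f by (cases "l < n") auto
    then show "\<exists>l\<in>{..<n}. (p, l) \<in> activation_pattern d n m D \<theta>"
      using i assms by (intro bexI[of _ i]) (auto simp: mem_activation_pattern_iff)
  next
    assume "\<exists>l\<in>{..<n}. (p, l) \<in> activation_pattern d n m D \<theta>"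
    then obtain l where "l < n" "?v j \<le> ?v l"
      using j by (auto simp: mem_activation_pattern_iff)
    with M[of l] f show "tropical_rational d n m \<theta> p \<ge> 0" by auto
  qed
qed

lemma err_cong_pattern:
  assumes nm: "n \<ge> 1" "m \<ge> 1"
    and eq: "activation_pattern d n m D \<theta> = activation_pattern d n m D \<theta>'"
  shows "err d n m D C \<theta> = err d n m D C \<theta>'"
proof -
  have "sgn (tropical_rational d n m \<theta> p) = sgn (tropical_rational d n m \<theta>' p)" if "p \<in> D" for p
    using tropical_rational_le_iff[OF nm that, of d \<theta>]
      tropical_rational_le_iff[OF nm that, of d \<theta>'] eq
    by (auto simp: sgn_if)
  then have "{p \<in> D. sgn (tropical_rational d n m \<theta> p) = - C p}
      = {p \<in> D. sgn (tropical_rational d n m \<theta>' p) = - C p}"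
    by auto
  then show ?thesis by (simp add: err_def)
qed

lemma continuous_on_affine_term: "continuous_on UNIV (\<lambda>\<theta>. affine_term d \<theta> l x)"
proof -
  have a: "continuous_on UNIV (\<lambda>\<theta>::param. fst \<theta> l)"
    by (rule continuous_on_product_then_coordinatewise[OF continuous_on_fst[OF continuous_on_id]])
  have "continuous_on UNIV (\<lambda>\<theta>::param. snd \<theta> l)"
    by (rule continuous_on_product_then_coordinatewise[OF continuous_on_snd[OF continuous_on_id]])
  then have s: "continuous_on UNIV (\<lambda>\<theta>::param. snd \<theta> l i)" for i
    by (rule continuous_on_product_then_coordinatewise)
  show ?thesis
    unfolding affine_term_def by (intro continuous_intros a s)
qed

lemma pattern_subset_of_mem_cone:
  assumes "\<theta> \<in> activation_cone d n m D G"
  shows "G \<subseteq> activation_pattern d n m D \<theta>"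
proof -
  let ?S = "{\<theta> \<in> param_space d n m. activation_pattern d n m D \<theta> = G}"
  have ne: "?S \<noteq> {}" using assms unfolding activation_cone_def by (metis closure_empty empty_iff)
  have "(p, l) \<in> activation_pattern d n m D \<theta>" if G: "(p, l) \<in> G" for p l
  proof -
    have pl: "p \<in> D" "l < n + m" using ne G mem_activation_pattern_iff by blast+
    have "affine_term d \<theta> l' p \<le> affine_term d \<theta> l p" if "l' < n + m" for l'
    proof -
      let ?H = "{\<eta>. affine_term d \<eta> l' p \<le> affine_term d \<eta> l p}"
      have "closed ?H" by (intro closed_Collect_le continuous_on_affine_term)
      moreover have "?S \<subseteq> ?H" using G that by (auto simp: mem_activation_pattern_iff)
      ultimately have "closure ?S \<subseteq> ?H" by (rule closure_minimal[rotated])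
      then show ?thesis using assms by (auto simp: activation_cone_def)
    qed
    then show ?thesis using pl by (simp add: mem_activation_pattern_iff)
  qed
  then show ?thesis by auto
qed

lemma activation_cone_inject:
  assumes "\<theta> \<in> param_space d n m" "\<theta>' \<in> param_space d n m"
    and eq: "activation_cone d n m D (activation_pattern d n m D \<theta>)
           = activation_cone d n m D (activation_pattern d n m D \<theta>')"
  shows "activation_pattern d n m D \<theta> = activation_pattern d n m D \<theta>'"
proof -
  have self: "\<eta> \<in> activation_cone d n m D (activation_pattern d n m D \<eta>)"
    if "\<eta> \<in> param_space d n m" for \<eta>
    unfolding activation_cone_def using that by (intro closure_subset[THEN subsetD]) auto
  show ?thesis
    using pattern_subset_of_mem_cone self[OF assms(1)] self[OF assms(2)] eq
    by (metis subset_antisym)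
qed

lemma err_cone_eq:
  assumes "n \<ge> 1" "m \<ge> 1" "\<theta> \<in> param_space d n m"
  shows "err_cone d n m D C (activation_cone d n m D (activation_pattern d n m D \<theta>))
       = err d n m D C \<theta>"
  unfolding err_cone_def
proof (rule the_equality)
  fix e
  assume "\<exists>\<theta>'\<in>param_space d n m.
      activation_cone d n m D (activation_pattern d n m D \<theta>')
        = activation_cone d n m D (activation_pattern d n m D \<theta>) \<and> err d n m D C \<theta>' = e"
  then show "e = err d n m D C \<theta>"
    using assms activation_cone_inject err_cong_pattern by metis
qed (use assms in blast)

end

theory Submission
  imports Defs
begin

text \<open>
  One dimension and one term on each side suffice: \<open>d = n = m = 1\<close>. Then \<open>f\<^sub>\<theta>\<close> is an affine
  function on the line, and a full-dimensional cone is a vector of nonzero signs that such a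
  function takes at the data points. For the points \<open>0, 1, 2\<close> the vectors \<open>+-+\<close> and \<open>-+-\<close>
  do not occur, since \<open>f\<^sub>\<theta>(1)\<close> is the mean of \<open>f\<^sub>\<theta>(0)\<close> and \<open>f\<^sub>\<theta>(2)\<close>, and the remaining six
  vectors are arranged in a cycle:
  \<open>+++, -++, --+, ---, +--, ++-\<close>. For the target \<open>+-+\<close> their losses are \<open>1, 2, 1, 2, 1, 2\<close>,
  so that each cone of loss \<open>1\<close> has only neighbors of loss \<open>2\<close>. With \<open>k = 1\<close> the cone of
  \<open>+++\<close> is therefore a component of the level set by itself, and it is separated from the
  cone of \<open>--+\<close> in the sublevel set.

  The geometric input is that crossing a wall of codimension \<open>1\<close> changes the active term at
  one data point only (\<open>adjacent_change_one_point\<close>, for all \<open>d, n, m\<close>): if the active terms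
  change at two different points, then the two cones meet inside the intersection of two
  different hyperplanes. A neighbor of the cone of \<open>+++\<close> thus has exactly one minus sign; it
  does not have it at the point \<open>1\<close>, and a minus sign at \<open>0\<close> or \<open>2\<close> adds an
  error to the one made at \<open>1\<close> (\<open>adjacent_to_positive_err\<close>).

  Besides this, cones of parameters with a single active term at each data point have to be
  recognized as full-dimensional and conversely
  (\<open>univalent_imp_full_dimensional\<close>, \<open>full_dimensional_imp_univalent\<close>), and dimensions have
  to be compared inside an infinite-dimensional type, where this is possible only for subsets
  of a finitely generated space.
\<close>

section \<open>Dimension inside a finitely generated space\<close>

text \<open>
  The function \<^const>\<open>dim\<close> gives the value \<open>0\<close> to every set without a finite basis, so it is
  monotone only below a finite generating set.
\<close>

lemma card_independent_le_dim:
  fixes B F :: "'a::real_vector set"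
  assumes "finite F" "V \<subseteq> span F" "independent B" "B \<subseteq> V"
  shows "card B \<le> dim V"
proof -
  obtain B' where B': "B \<subseteq> B'" "B' \<subseteq> V" "independent B'" "V \<subseteq> span B'"
    using maximal_independent_subset_extend[OF assms(4,3)] by metis
  have "finite B'"
    using independent_span_bound[OF assms(1) B'(3)] B'(2) assms(2) by blast
  moreover have "dim V = card B'"
    using B' by (intro dim_unique[of B']) auto
  ultimately show ?thesis
    using B'(1) by (auto intro: finite_subset card_mono)
qed

lemma dim_insert_outside_span:
  fixes X F :: "'a::real_vector set"
  assumes "finite F" "insert x X \<subseteq> span F" "x \<notin> span X"
  shows "dim (insert x X) = dim X + 1"
proof -
  obtain B where B: "B \<subseteq> X" "independent B" "X \<subseteq> span B" "card B = dim X"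
    using basis_exists[of X] by metis
  have "finite B"
    using independent_span_bound[OF assms(1) B(2)] B(1) assms(2) by blast
  have "span B = span X"
    using B(1,3) by (metis span_mono span_minimal subspace_span subset_antisym)
  then have xB: "x \<notin> span B" using assms(3) by simp
  have "dim (insert x X) = card (insert x B)"
  proof (rule dim_unique)
    show "insert x X \<subseteq> span (insert x B)"
      using B(3) span_mono[of B "insert x B"] by (auto intro: span_base)
    show "independent (insert x B)"
      using B(2) xB by (simp add: independent_insert)
  qed (use B(1) in auto)
  then show ?thesis
    using xB \<open>finite B\<close> B(4) by (metis Suc_eq_plus1 card_insert_disjoint span_base)
qed

lemma dim_mono_in_finite_span:
  fixes V F :: "'a::real_vector set"
  assumes "finite F" "V \<subseteq> span F" "X \<subseteq> V"
  shows "dim X \<le> dim V"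
proof -
  obtain B where "B \<subseteq> X" "independent B" "card B = dim X"
    using basis_exists[of X] by metis
  then show ?thesis
    using card_independent_le_dim[OF assms(1,2), of B] assms(3) by auto
qed

section \<open>The parameter space\<close>

text \<open>
  The parameter whose term \<open>l\<close> is \<open>c + r x\<^sub>i\<close> and whose other terms vanish. Such parameters
  generate the parameter space, and they also serve as test vectors off a given hyperplane.
\<close>

definition monomial_param :: "nat \<Rightarrow> nat \<Rightarrow> real \<Rightarrow> real \<Rightarrow> param" where
  "monomial_param l i c r =
     ((\<lambda>l'. if l' = l then c else 0), (\<lambda>l' i'. if l' = l \<and> i' = i then r else 0))"

lemma sum_function_apply: "(\<Sum>x\<in>A. f x) y = (\<Sum>x\<in>A. f x y)"
  for f :: "'a \<Rightarrow> 'b \<Rightarrow> 'c::comm_monoid_add"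
  by (induction A rule: infinite_finite_induct) auto

lemma param_space_finitely_generated:
  "\<exists>F. finite F \<and> param_space d n m \<subseteq> span F"
proof (intro exI conjI)
  let ?F = "(\<lambda>l. monomial_param l 0 1 0) ` {..<n + m}
    \<union> (\<lambda>(l, i). monomial_param l i 0 1) ` ({..<n + m} \<times> {..<d})"
  show "finite ?F" by simp
  show "param_space d n m \<subseteq> span ?F"
  proof
    fix \<theta> :: param
    assume \<theta>: "\<theta> \<in> param_space d n m"
    obtain a s where as: "\<theta> = (a, s)" by force
    have a0: "a l = 0" and s0: "s l = 0" if "\<not> l < n + m" for l
      using \<theta> that by (auto simp: as param_space_def)
    have s1: "s l i = 0" if "\<not> i < d" for l i
      using \<theta> that s0[of l] by (cases "l < n + m") (auto simp: as param_space_def real_space_def)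
    have "\<theta> = (\<Sum>l<n + m. a l *\<^sub>R monomial_param l 0 1 0)
        + (\<Sum>l<n + m. \<Sum>i<d. s l i *\<^sub>R monomial_param l i 0 1)"
    proof (rule prod_eqI)
      show "fst \<theta> = fst ((\<Sum>l<n + m. a l *\<^sub>R monomial_param l 0 1 0)
        + (\<Sum>l<n + m. \<Sum>i<d. s l i *\<^sub>R monomial_param l i 0 1))"
        by (rule ext) (use a0 in \<open>auto simp: as fst_sum sum_function_apply monomial_param_def
            scaleR_fun_def if_distrib if_distribR sum.delta' cong: if_cong\<close>)
      have "(\<Sum>l'<n + m. \<Sum>i'<d. s l' i' * (if l = l' \<and> i = i' then 1 else 0)) = s l i" for l i
      proof -
        have "(\<Sum>i'<d. s l' i' * (if l = l' \<and> i = i' then 1 else 0))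
            = (if l = l' then s l i else 0)" for l'
          using s1[of i l] by (cases "l = l'") (simp_all add: mult_delta_right)
        then show ?thesis using s0[of l] by simp
      qed
      then show "snd \<theta> = snd ((\<Sum>l<n + m. a l *\<^sub>R monomial_param l 0 1 0)
        + (\<Sum>l<n + m. \<Sum>i<d. s l i *\<^sub>R monomial_param l i 0 1))"
        by (intro ext) (simp add: as snd_sum sum_function_apply monomial_param_def scaleR_fun_def)
    qed
    also have "\<dots> \<in> span ?F"
      by (intro span_add span_sum span_scale span_base) auto
    finally show "\<theta> \<in> span ?F" .
  qed
qed

lemma subspace_param_space: "subspace (param_space d n m)"
  by (auto simp: subspace_def param_space_def real_space_def scaleR_fun_def zero_prod_def)

lemma closed_param_space: "closed (param_space d n m)"
proof -
  have a: "continuous_on UNIV (\<lambda>\<theta>::param. fst \<theta> l)" for l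
    by (rule continuous_on_product_then_coordinatewise[OF continuous_on_fst[OF continuous_on_id]])
  have "continuous_on UNIV (\<lambda>\<theta>::param. snd \<theta> l)" for l
    by (rule continuous_on_product_then_coordinatewise[OF continuous_on_snd[OF continuous_on_id]])
  then have s: "continuous_on UNIV (\<lambda>\<theta>::param. snd \<theta> l i)" for l i
    by (rule continuous_on_product_then_coordinatewise)
  have "param_space d n m = (\<Inter>l\<in>{n + m..}. {\<theta>. fst \<theta> l = 0})
      \<inter> (\<Inter>l\<in>{n + m..}. \<Inter>i. {\<theta>. snd \<theta> l i = 0})
      \<inter> (\<Inter>l\<in>{..<n + m}. \<Inter>i\<in>{d..}. {\<theta>. snd \<theta> l i = 0})"
    by (auto simp: param_space_def real_space_def fun_eq_iff)
  also have "closed \<dots>"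
    by (intro closed_Int closed_INT ballI closed_Collect_eq a s continuous_on_const)
  finally show ?thesis .
qed

lemma activation_cone_subset_param_space: "activation_cone d n m D G \<subseteq> param_space d n m"
  unfolding activation_cone_def by (rule closure_minimal[OF _ closed_param_space]) auto

lemma linear_affine_term: "linear (\<lambda>\<theta>. affine_term d \<theta> l x)"
  by (rule linearI)
    (simp_all add: affine_term_def scaleR_fun_def sum.distrib sum_distrib_left algebra_simps)

lemma affine_term_monomial_param:
  "i < d \<Longrightarrow> affine_term d (monomial_param l i c r) l' x = (if l' = l then c + r * x i else 0)"
  by (simp add: affine_term_def monomial_param_def if_distrib if_distribR cong: if_cong)

lemma affine_term_constant_param:
  "affine_term d (monomial_param l i c 0) l' x = (if l' = l then c else 0)"
  by (simp add: affine_term_def monomial_param_def)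

lemma monomial_param_mem: "l < n + m \<Longrightarrow> i < d \<Longrightarrow> monomial_param l i c r \<in> param_space d n m"
  by (auto simp: param_space_def monomial_param_def real_space_def fun_eq_iff)

lemma constant_param_mem: "l < n + m \<Longrightarrow> monomial_param l i c 0 \<in> param_space d n m"
  by (auto simp: param_space_def monomial_param_def real_space_def fun_eq_iff)

section \<open>Full-dimensional cones and their walls\<close>

text \<open>
  These turn out to be the patterns of the full-dimensional cones.
\<close>

definition univalent_pattern :: "(point \<times> nat) set \<Rightarrow> bool" where
  "univalent_pattern G \<longleftrightarrow> (\<forall>p l l'. (p, l) \<in> G \<longrightarrow> (p, l') \<in> G \<longrightarrow> l = l')"

lemma mem_own_cone:
  "\<theta> \<in> param_space d n m \<Longrightarrow> \<theta> \<in> activation_cone d n m D (activation_pattern d n m D \<theta>)"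
  unfolding activation_cone_def by (intro closure_subset[THEN subsetD]) auto

lemma classification_fan_iff:
  "K \<in> classification_fan d n m D \<longleftrightarrow>
     (\<exists>\<theta>\<in>param_space d n m. K = activation_cone d n m D (activation_pattern d n m D \<theta>))"
proof
  assume "K \<in> classification_fan d n m D"
  then obtain G where G: "K = activation_cone d n m D G" "K \<noteq> {}"
    by (auto simp: classification_fan_def)
  have "{\<theta> \<in> param_space d n m. activation_pattern d n m D \<theta> = G} \<noteq> {}"
    using G closure_empty unfolding activation_cone_def by metis
  then show "\<exists>\<theta>\<in>param_space d n m. K = activation_cone d n m D (activation_pattern d n m D \<theta>)"
    using G(1) by blast
next
  assume "\<exists>\<theta>\<in>param_space d n m. K = activation_cone d n m D (activation_pattern d n m D \<theta>)"
  then show "K \<in> classification_fan d n m D"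
    using mem_own_cone unfolding classification_fan_def activation_pattern_def by fastforce
qed

lemma active_index_exists:
  assumes "n + m > 0" "p \<in> D"
  shows "\<exists>l. (p, l) \<in> activation_pattern d n m D \<theta>"
proof -
  have "Max ((\<lambda>l. affine_term d \<theta> l p) ` {..<n + m}) \<in> (\<lambda>l. affine_term d \<theta> l p) ` {..<n + m}"
    using assms(1) by (intro Max_in) (auto simp: lessThan_empty_iff)
  then show ?thesis using assms(2) by (auto simp: activation_pattern_def)
qed

lemma active_terms_equal:
  assumes "(p, l) \<in> activation_pattern d n m D \<theta>" "(p, l') \<in> activation_pattern d n m D \<theta>"
  shows "affine_term d \<theta> l p - affine_term d \<theta> l' p = 0"
  using assms by (simp add: activation_pattern_def)

text \<open>
  A univalent pattern is given by finitely many strict inequalities, which survive a small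
  perturbation of the parameter in any direction.
\<close>

lemma univalent_pattern_locally_constant:
  assumes "finite D" "n + m > 0"
    and uni: "univalent_pattern (activation_pattern d n m D \<theta>)"
  shows "\<forall>\<^sub>F t in at_right 0.
    activation_pattern d n m D (\<theta> + t *\<^sub>R \<eta>) = activation_pattern d n m D \<theta>"
proof -
  let ?v = "\<lambda>t l p. affine_term d (\<theta> + t *\<^sub>R \<eta>) l p"
  have v: "?v t l p = affine_term d \<theta> l p + t * affine_term d \<eta> l p" for t l p
    by (simp add: linear_add[OF linear_affine_term] linear_scale[OF linear_affine_term])
  have finite_pattern: "finite (activation_pattern d n m D \<theta>)"
    by (rule finite_subset[of _ "D \<times> {..<n + m}"])
      (use assms(1) in \<open>auto simp: activation_pattern_def\<close>)
  have "\<forall>\<^sub>F t in at_right 0. ?v t l' p < ?v t l p"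
    if "(p, l) \<in> activation_pattern d n m D \<theta>" "l' < n + m" "l' \<noteq> l" for p l l'
  proof -
    have "(p, l') \<notin> activation_pattern d n m D \<theta>"
      using that uni by (auto simp: univalent_pattern_def)
    then have less: "affine_term d \<theta> l' p < affine_term d \<theta> l p"
      using that by (force simp: mem_activation_pattern_iff)
    have "((\<lambda>t. ?v t j p) \<longlongrightarrow> affine_term d \<theta> j p) (at_right 0)" for j
      unfolding v by (auto intro!: tendsto_eq_intros)
    from order_tendstoD[OF tendsto_diff[OF this[of l] this[of l']], of 0] less
    have "\<forall>\<^sub>F t in at_right 0. 0 < ?v t l p - ?v t l' p" by simp
    then show ?thesis by (rule eventually_mono) simp
  qed
  then have "\<forall>\<^sub>F t in at_right 0. \<forall>z\<in>activation_pattern d n m D \<theta>. \<forall>l'\<in>{..<n + m} - {snd z}.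
      ?v t l' (fst z) < ?v t (snd z) (fst z)"
    by (intro eventually_ball_finite ballI finite_pattern finite_Diff finite_lessThan) auto
  then show ?thesis
  proof (rule eventually_mono)
    fix t
    assume t: "\<forall>z\<in>activation_pattern d n m D \<theta>. \<forall>l'\<in>{..<n + m} - {snd z}.
      ?v t l' (fst z) < ?v t (snd z) (fst z)"
    have sub: "(p, l) \<in> activation_pattern d n m D (\<theta> + t *\<^sub>R \<eta>)"
      and only: "(p, l') \<in> activation_pattern d n m D (\<theta> + t *\<^sub>R \<eta>) \<Longrightarrow> l' = l"
      if "(p, l) \<in> activation_pattern d n m D \<theta>" for p l l'
    proof -
      have pl: "p \<in> D" "l < n + m" using that by (auto simp: mem_activation_pattern_iff)
      have less: "?v t j p < ?v t l p" if "j < n + m" "j \<noteq> l" for j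
        using t \<open>(p, l) \<in> activation_pattern d n m D \<theta>\<close> that by force
      show "(p, l) \<in> activation_pattern d n m D (\<theta> + t *\<^sub>R \<eta>)"
        unfolding mem_activation_pattern_iff using pl less by (metis less_imp_le order_refl)
      show "l' = l" if "(p, l') \<in> activation_pattern d n m D (\<theta> + t *\<^sub>R \<eta>)"
        using that less[of l'] pl(2) unfolding mem_activation_pattern_iff by (metis not_less)
    qed
    show "activation_pattern d n m D (\<theta> + t *\<^sub>R \<eta>) = activation_pattern d n m D \<theta>"
    proof (intro equalityI subrelI)
      fix p l
      assume pl: "(p, l) \<in> activation_pattern d n m D (\<theta> + t *\<^sub>R \<eta>)"
      then have "p \<in> D" by (simp add: mem_activation_pattern_iff)
      then obtain j where j: "(p, j) \<in> activation_pattern d n m D \<theta>"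
        using active_index_exists[OF assms(2)] by blast
      with only[OF j pl] show "(p, l) \<in> activation_pattern d n m D \<theta>" by simp
    qed (rule sub)
  qed
qed

text \<open>
  Any direction \<open>\<eta>\<close> is a multiple of the difference of \<open>\<theta> + t \<eta>\<close> and \<open>\<theta>\<close>, which both lie in the
  cone for small \<open>t > 0\<close>. So the cone spans the whole parameter space.
\<close>

lemma univalent_imp_full_dimensional:
  assumes "finite D" "n + m > 0" "\<theta> \<in> param_space d n m"
    and uni: "univalent_pattern (activation_pattern d n m D \<theta>)"
  shows "full_dimensional d n m (activation_cone d n m D (activation_pattern d n m D \<theta>))"
proof -
  let ?K = "activation_cone d n m D (activation_pattern d n m D \<theta>)"
  have "\<eta> \<in> span ?K" if \<eta>: "\<eta> \<in> param_space d n m" for \<eta>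
  proof -
    have "\<forall>\<^sub>F t in at_right (0::real). t > 0 \<and>
        activation_pattern d n m D (\<theta> + t *\<^sub>R \<eta>) = activation_pattern d n m D \<theta>"
      by (intro eventually_conj eventually_at_right_less
          univalent_pattern_locally_constant[OF assms(1,2) uni])
    from eventually_happens'[OF _ this] obtain t :: real where t: "t > 0"
      "activation_pattern d n m D (\<theta> + t *\<^sub>R \<eta>) = activation_pattern d n m D \<theta>"
      by auto
    have "\<theta> + t *\<^sub>R \<eta> \<in> param_space d n m"
      using \<eta> assms(3) by (intro subspace_add subspace_scale subspace_param_space)
    from mem_own_cone[OF this, of D] t(2) have "\<theta> + t *\<^sub>R \<eta> \<in> ?K" by simp
    with mem_own_cone[OF assms(3)] have "(1 / t) *\<^sub>R ((\<theta> + t *\<^sub>R \<eta>) - \<theta>) \<in> span ?K"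
      by (intro span_scale span_diff span_base)
    moreover have "(1 / t) *\<^sub>R ((\<theta> + t *\<^sub>R \<eta>) - \<theta>) = \<eta>" using t(1) by simp
    ultimately show ?thesis by simp
  qed
  moreover have "span ?K \<subseteq> param_space d n m"
    by (rule span_minimal[OF activation_cone_subset_param_space subspace_param_space])
  ultimately have "span ?K = param_space d n m" by blast
  then show ?thesis unfolding full_dimensional_def by (metis dim_span)
qed

text \<open>
  This is meant for iteration. If several functionals vanish on \<open>X\<close>, adjoin to \<open>X\<close>, one
  after another, vectors at which the next functional does not vanish but all later ones do. Each
  step raises the dimension by one, so the codimension of \<open>X\<close> is at least the number of
  functionals.
\<close>

lemma dim_insert_off_hyperplane:
  assumes "X \<subseteq> param_space d n m" "\<phi> \<in> param_space d n m"
    and "linear f" "\<And>\<theta>. \<theta> \<in> X \<Longrightarrow> f \<theta> = (0::real)" "f \<phi> \<noteq> 0"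
  shows "dim (insert \<phi> X) = dim X + 1 \<and> dim X + 1 \<le> dim (param_space d n m)"
proof -
  obtain F where F: "finite F" "param_space d n m \<subseteq> span F"
    using param_space_finitely_generated by blast
  have "span X \<subseteq> {\<theta>. f \<theta> = 0}"
    using assms(4) linear_subspace_kernel[OF assms(3)] by (intro span_minimal) auto
  then have "dim (insert \<phi> X) = dim X + 1"
    using assms(1,2,5) F by (intro dim_insert_outside_span[of F]) auto
  moreover have "dim (insert \<phi> X) \<le> dim (param_space d n m)"
    using assms(1,2) by (intro dim_mono_in_finite_span[OF F]) auto
  ultimately show ?thesis by simp
qed

text \<open>
  Two active terms at one data point agree there on the whole cone, which confines the cone to
  a hyperplane.
\<close>

lemma full_dimensional_imp_univalent:
  assumes "full_dimensional d n m (activation_cone d n m D (activation_pattern d n m D \<theta>))"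
  shows "univalent_pattern (activation_pattern d n m D \<theta>)"
  unfolding univalent_pattern_def
proof (intro allI impI, rule ccontr)
  fix p l l'
  let ?G = "activation_pattern d n m D \<theta>"
  let ?f = "\<lambda>\<eta>. affine_term d \<eta> l p - affine_term d \<eta> l' p"
  assume G: "(p, l) \<in> ?G" "(p, l') \<in> ?G" and ne: "l \<noteq> l'"
  have zero: "?f \<eta> = 0" if "\<eta> \<in> activation_cone d n m D ?G" for \<eta>
    using pattern_subset_of_mem_cone[OF that] G active_terms_equal by blast
  have lin: "linear ?f" by (intro linear_compose_sub linear_affine_term)
  have mem: "monomial_param l 0 1 0 \<in> param_space d n m"
    using G(1) by (intro constant_param_mem) (simp add: mem_activation_pattern_iff)
  have "?f (monomial_param l 0 1 0) \<noteq> 0"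
    using ne by (simp add: affine_term_constant_param)
  from dim_insert_off_hyperplane[OF activation_cone_subset_param_space[of d n m D ?G] mem lin
      zero this] assms
  show False by (simp add: full_dimensional_def)
qed

text \<open>
  A parameter in both cones has the active terms of both: at \<open>p\<close> the terms \<open>l, l'\<close> agree, and at
  \<open>q\<close> the terms \<open>k, k'\<close> agree. If \<open>l \<noteq> l'\<close> and \<open>k \<noteq> k'\<close>, these are two independent linear
  conditions, because \<open>p \<noteq> q\<close>; then the intersection has codimension at least \<open>2\<close>.
\<close>

lemma adjacent_change_one_point:
  assumes adj: "adjacent d n m (activation_cone d n m D (activation_pattern d n m D \<theta>))
      (activation_cone d n m D (activation_pattern d n m D \<theta>'))"
    and D: "D \<subseteq> real_space d" and pq: "p \<noteq> q"
    and p: "(p, l) \<in> activation_pattern d n m D \<theta>" "(p, l') \<in> activation_pattern d n m D \<theta>'"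
    and q: "(q, k) \<in> activation_pattern d n m D \<theta>" "(q, k') \<in> activation_pattern d n m D \<theta>'"
  shows "l = l' \<or> k = k'"
proof (rule ccontr)
  assume "\<not> (l = l' \<or> k = k')"
  then have ne: "l \<noteq> l'" "k \<noteq> k'" by auto
  let ?X = "activation_cone d n m D (activation_pattern d n m D \<theta>)
      \<inter> activation_cone d n m D (activation_pattern d n m D \<theta>')"
  let ?f = "\<lambda>\<eta>. affine_term d \<eta> l p - affine_term d \<eta> l' p"
  let ?g = "\<lambda>\<eta>. affine_term d \<eta> k q - affine_term d \<eta> k' q"
  have lin: "linear ?f" "linear ?g" by (intro linear_compose_sub linear_affine_term)+
  have zero: "?f \<eta> = 0" "?g \<eta> = 0" if "\<eta> \<in> ?X" for \<eta>
  proof -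
    have "activation_pattern d n m D \<theta> \<subseteq> activation_pattern d n m D \<eta>"
      "activation_pattern d n m D \<theta>' \<subseteq> activation_pattern d n m D \<eta>"
      using that by (auto dest!: pattern_subset_of_mem_cone)
    then show "?f \<eta> = 0" "?g \<eta> = 0"
      using p q by (meson active_terms_equal subsetD)+
  qed
  have "p \<in> real_space d" "q \<in> real_space d"
    using p q D by (auto simp: mem_activation_pattern_iff)
  then obtain i where i: "i < d" "p i \<noteq> q i"
    using pq by (auto simp: real_space_def fun_eq_iff) (metis not_less)
  \<comment> \<open>All terms of \<open>\<phi>\<close> vanish at \<open>q\<close>, so adding \<open>\<phi>\<close> leaves the hyperplane given by \<open>p\<close> but stays
    in the one given by \<open>q\<close>; then \<open>\<psi>\<close> leaves the latter.\<close>
  let ?\<phi> = "monomial_param l i (- q i) 1" and ?\<psi> = "monomial_param k i (- p i) 1"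
  have lk: "l < n + m" "k < n + m" using p q by (auto simp: mem_activation_pattern_iff)
  have mem: "?\<phi> \<in> param_space d n m" "?\<psi> \<in> param_space d n m" "?X \<subseteq> param_space d n m"
    using lk i(1) activation_cone_subset_param_space[of d n m D "activation_pattern d n m D \<theta>"]
    by (auto simp del: split_paired_All intro: monomial_param_mem)
  have "dim (insert ?\<phi> ?X) = dim ?X + 1"
    using dim_insert_off_hyperplane[OF mem(3,1) lin(1)] zero(1) i ne
    by (simp add: affine_term_monomial_param)
  moreover have "dim (insert ?\<phi> ?X) + 1 \<le> dim (param_space d n m)"
  proof (rule dim_insert_off_hyperplane[OF _ mem(2) lin(2), THEN conjunct2])
    show "insert ?\<phi> ?X \<subseteq> param_space d n m" using mem by simp
    show "?g \<eta> = 0" if "\<eta> \<in> insert ?\<phi> ?X" for \<eta>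
      using that zero(2)[of \<eta>] i(1) by (auto simp: affine_term_monomial_param)
    show "?g ?\<psi> \<noteq> 0" using i ne by (simp add: affine_term_monomial_param)
  qed
  ultimately show False using adj by (simp add: adjacent_def)
qed

section \<open>Isolated cones\<close>

lemma not_adjacent_self: "\<not> adjacent d n m K K"
  by (auto simp: adjacent_def full_dimensional_def)

lemma isolated_cone_path:
  assumes "(\<lambda>K' L'. K' \<in> S \<and> L' \<in> S \<and> adjacent d n m K' L')\<^sup>*\<^sup>* K L"
    and "\<And>L. L \<in> S \<Longrightarrow> \<not> adjacent d n m K L"
  shows "L = K"
  using assms(1)
proof (cases rule: converse_rtranclpE)
  case (step L')
  then show ?thesis using assms(2)[of L'] by simp
qed simp

text \<open>
  A strongly connected collection that contains an isolated cone consists of it alone, since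
  there is no path from it to any other cone.
\<close>

lemma isolated_cone_component:
  assumes "K \<in> S" "full_dimensional d n m K" "\<And>L. L \<in> S \<Longrightarrow> \<not> adjacent d n m K L"
  shows "{K} \<in> strong_components d n m S"
proof -
  have "T = {K}" if T: "{K} \<subseteq> T" "T \<subseteq> {L \<in> S. full_dimensional d n m L}"
    "strongly_connected d n m T" for T
  proof -
    have "L = K" if "L \<in> T" for L
    proof (rule isolated_cone_path)
      show "(\<lambda>K' L'. K' \<in> T \<and> L' \<in> T \<and> adjacent d n m K' L')\<^sup>*\<^sup>* K L"
        using T that assms(2) unfolding strongly_connected_def by blast
    qed (use T(2) assms(3) in blast)
    then show ?thesis using T(1) by blast
  qed
  moreover have "strongly_connected d n m {K}" by (simp add: strongly_connected_def)
  ultimately show ?thesis using assms(1,2) by (auto simp: strong_components_def)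
qed

section \<open>Three points on a line\<close>

definition pt :: "real \<Rightarrow> point" where
  "pt x = (\<lambda>i. if i = 0 then x else 0)"

definition three_points :: "point set" where
  "three_points = {pt 0, pt 1, pt 2}"

definition alternating :: "point \<Rightarrow> real" where
  "alternating p = (if p = pt 1 then - 1 else 1)"

abbreviation "diff_at \<theta> x \<equiv> tropical_rational 1 1 1 \<theta> (pt x)"

abbreviation "pattern \<equiv> activation_pattern 1 1 1 three_points"

abbreviation "cone_of \<theta> \<equiv> activation_cone 1 1 1 three_points (pattern \<theta>)"

lemma pt_eq_iff [simp]: "pt x = pt y \<longleftrightarrow> x = y"
  by (auto simp: pt_def fun_eq_iff)

lemma diff_at_eq: "diff_at \<theta> x = affine_term 1 \<theta> 0 (pt x) - affine_term 1 \<theta> 1 (pt x)"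
proof -
  have "{1..<1 + 1} = {1::nat}" "{..<1} = {0::nat}" by auto
  then show ?thesis by (simp add: tropical_rational_def)
qed

lemma diff_at_convex: "diff_at \<theta> 0 + diff_at \<theta> 2 = 2 * diff_at \<theta> 1"
  unfolding diff_at_eq by (simp add: affine_term_def pt_def)

lemma mem_pattern:
  "(pt x, 0) \<in> pattern \<theta> \<longleftrightarrow> pt x \<in> three_points \<and> diff_at \<theta> x \<ge> 0"
  "(pt x, 1) \<in> pattern \<theta> \<longleftrightarrow> pt x \<in> three_points \<and> diff_at \<theta> x \<le> 0"
  unfolding diff_at_eq by (auto simp: mem_activation_pattern_iff less_Suc_eq)

lemma univalent_iff:
  "univalent_pattern (pattern \<theta>) \<longleftrightarrow> (\<forall>x\<in>{0, 1, 2}. diff_at \<theta> x \<noteq> 0)"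
proof
  assume uni: "univalent_pattern (pattern \<theta>)"
  show "\<forall>x\<in>{0, 1, 2}. diff_at \<theta> x \<noteq> 0"
  proof (intro ballI notI)
    fix x :: real
    assume "x \<in> {0, 1, 2}" "diff_at \<theta> x = 0"
    then have "(pt x, 0) \<in> pattern \<theta>" "(pt x, 1) \<in> pattern \<theta>"
      unfolding mem_pattern by (auto simp: three_points_def)
    with uni show False by (force simp: univalent_pattern_def)
  qed
next
  assume ne: "\<forall>x\<in>{0, 1, 2}. diff_at \<theta> x \<noteq> 0"
  have "l = l'" if G: "(p, l) \<in> pattern \<theta>" "(p, l') \<in> pattern \<theta>" for p l l'
  proof -
    obtain x where x: "p = pt x" "x \<in> {0, 1, 2}"
      using G by (auto simp: mem_activation_pattern_iff three_points_def)
    have "l \<in> {0, 1}" "l' \<in> {0, 1}"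
      using G by (auto simp: mem_activation_pattern_iff)
    with G ne x show ?thesis by (force simp: mem_pattern[unfolded One_nat_def])
  qed
  then show "univalent_pattern (pattern \<theta>)" by (auto simp: univalent_pattern_def)
qed

text \<open>
  A zero of \<open>f\<^sub>\<theta>\<close> at a data point is not counted as an error, so every inequality is strict.
\<close>

lemma err_three_points:
  "err 1 1 1 three_points alternating \<theta>
    = of_bool (diff_at \<theta> 0 < 0) + of_bool (diff_at \<theta> 1 > 0) + of_bool (diff_at \<theta> 2 < 0)"
proof -
  have "{p \<in> three_points. sgn (tropical_rational 1 1 1 \<theta> p) = - alternating p}
     = (if diff_at \<theta> 0 < 0 then {pt 0} else {}) \<union> (if diff_at \<theta> 1 > 0 then {pt 1} else {})
       \<union> (if diff_at \<theta> 2 < 0 then {pt 2} else {})"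
    by (auto simp: three_points_def alternating_def sgn_if split: if_splits)
  then show ?thesis by (simp add: err_def)
qed

text \<open>
  At most one sign changes on the way from \<open>+++\<close> to an adjacent cone, and at least one
  changes because no cone is adjacent to itself. It is not the middle one, by the mean value
  relation, so the error at \<open>1\<close> persists and a second one arises.
\<close>

lemma adjacent_to_positive_err:
  assumes pos: "\<forall>x\<in>{0, 1, 2}. diff_at \<theta> x > 0"
    and adj: "adjacent 1 1 1 (cone_of \<theta>) (cone_of \<theta>')"
  shows "err 1 1 1 three_points alternating \<theta>' > 1"
proof -
  have ne: "\<forall>x\<in>{0, 1, 2}. diff_at \<theta>' x \<noteq> 0"
    using full_dimensional_imp_univalent adj univalent_iff unfolding adjacent_def by blast
  have one: "diff_at \<theta>' x > 0 \<or> diff_at \<theta>' y > 0"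
    if "x \<in> {0, 1, 2}" "y \<in> {0, 1, 2}" "x \<noteq> y" for x y
  proof (rule ccontr)
    assume neg: "\<not> (diff_at \<theta>' x > 0 \<or> diff_at \<theta>' y > 0)"
    have mem: "pt x \<in> three_points" "pt y \<in> three_points"
      using that by (auto simp: three_points_def)
    have "(0::nat) = 1 \<or> (0::nat) = 1"
    proof (rule adjacent_change_one_point[OF adj])
      show "three_points \<subseteq> real_space 1" by (auto simp: three_points_def real_space_def pt_def)
      show "pt x \<noteq> pt y" using that by simp
    qed (use that pos neg mem in \<open>auto simp: mem_pattern less_imp_le simp del: One_nat_def\<close>)
    then show False by simp
  qed
  have "\<exists>x\<in>{0, 1, 2}. diff_at \<theta>' x < 0"
  proof (rule ccontr)
    assume "\<not> (\<exists>x\<in>{0, 1, 2}. diff_at \<theta>' x < 0)"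
    then have pos': "\<forall>x\<in>{0, 1, 2}. diff_at \<theta>' x > 0" using ne by force
    have "pattern \<eta> = three_points \<times> {0}" if \<eta>: "\<forall>x\<in>{0, 1, 2}. diff_at \<eta> x > 0" for \<eta>
    proof (intro equalityI subrelI)
      fix p l
      assume G: "(p, l) \<in> pattern \<eta>"
      then obtain x where x: "p = pt x" "x \<in> {0, 1, 2}"
        by (auto simp: mem_activation_pattern_iff three_points_def)
      have l: "l = 0 \<or> l = 1" using G by (auto simp: mem_activation_pattern_iff)
      show "(p, l) \<in> three_points \<times> {0}"
        using G x l \<eta> by (auto simp: mem_pattern[unfolded One_nat_def])
    next
      fix p and l :: nat
      assume "(p, l) \<in> three_points \<times> {0}"
      then obtain x where "p = pt x" "x \<in> {0, 1, 2}" "pt x \<in> three_points" "l = 0"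
        by (auto simp: three_points_def)
      with \<eta> show "(p, l) \<in> pattern \<eta>"
        by (auto simp: mem_pattern less_imp_le simp del: One_nat_def)
    qed
    then have "pattern \<theta>' = pattern \<theta>" using pos pos' by simp
    with adj show False by (simp add: not_adjacent_self)
  qed
  then show ?thesis
    using one[of 0 1] one[of 0 2] one[of 1 2] diff_at_convex[of \<theta>']
    unfolding err_three_points by auto
qed

theorem theorem6p17:
  shows "\<exists>(d::nat) (n::nat) (m::nat) (D::point set) (C\<^sub>0::point \<Rightarrow> real) (k::nat).
           d \<ge> 1 \<and> n \<ge> 1 \<and> m \<ge> 1 \<and>
           finite D \<and> D \<subseteq> real_space d \<and> general_position d D \<and> dichotomy D C\<^sub>0 \<and>
           \<not> strongly_connected d n m (sublevel_set d n m D C\<^sub>0 k) \<and>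
           (\<exists>C \<in> strong_components d n m (level_set d n m D C\<^sub>0 k).
              \<forall>K \<in> neighbors d n m D C. err_cone d n m D C\<^sub>0 K > k)"
proof -
  \<comment> \<open>The functions \<open>f = 1\<close> and \<open>f = x - 3/2\<close>, with signs \<open>+++\<close> and \<open>--+\<close>.\<close>
  let ?\<theta> = "monomial_param 0 0 1 0" and ?\<eta> = "monomial_param 0 0 (- (3 / 2)) 1"
  let ?K = "cone_of ?\<theta>" and ?L = "cone_of ?\<eta>"
  let ?lev = "level_set 1 1 1 three_points alternating 1"
  let ?sub = "sublevel_set 1 1 1 three_points alternating 1"
  have D: "finite three_points" "three_points \<subseteq> real_space 1"
    by (auto simp: three_points_def real_space_def pt_def)
  have gp: "general_position 1 three_points"
    unfolding general_position_def
  proof (intro allI impI notI, elim conjE exE)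
    fix S u b
    assume S: "S \<subseteq> three_points" "card S = 1 + 1"
      and u: "u \<in> real_space 1" "u \<noteq> 0" "\<forall>x\<in>S. (\<Sum>i<1. u i * x i) = b"
    obtain p q where pq: "S = {p, q}" "p \<noteq> q" using S(2) by (metis card_2_iff one_add_one)
    obtain x y where xy: "p = pt x" "q = pt y" using S(1) pq by (auto simp: three_points_def)
    have "u 0 \<noteq> 0"
    proof
      assume "u 0 = 0"
      then have "u i = 0" for i using u(1) by (cases i) (auto simp: real_space_def)
      with u(2) show False by (simp add: fun_eq_iff)
    qed
    moreover have "u 0 * x = u 0 * y" using u(3) pq xy by (simp add: pt_def)
    ultimately show False using pq xy by simp
  qed
  have dich: "dichotomy three_points alternating" by (simp add: dichotomy_def alternating_def)
  have mem: "?\<theta> \<in> param_space 1 1 1" "?\<eta> \<in> param_space 1 1 1"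
    by (auto intro: monomial_param_mem)
  have val: "diff_at ?\<theta> x = 1" "diff_at ?\<eta> x = x - 3 / 2" for x
    unfolding diff_at_eq by (simp_all add: affine_term_monomial_param pt_def)
  have full: "full_dimensional 1 1 1 ?K" "full_dimensional 1 1 1 ?L"
    using D(1) mem
    by (auto intro!: univalent_imp_full_dimensional simp: univalent_iff val simp del: One_nat_def)
  have err_cone: "err_cone 1 1 1 three_points alternating (cone_of \<zeta>)
      = err 1 1 1 three_points alternating \<zeta>" if "\<zeta> \<in> param_space 1 1 1" for \<zeta>
    using that by (intro err_cone_eq) auto
  have lev: "?K \<in> ?lev" "?L \<in> ?lev"
    using mem by (auto simp: level_set_def classification_fan_iff err_cone err_three_points val
        simp del: One_nat_def)
  have nbr: "err_cone 1 1 1 three_points alternating M > 1"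
    if "M \<in> classification_fan 1 1 1 three_points" "adjacent 1 1 1 ?K M" for M
  proof -
    obtain \<zeta> where \<zeta>: "\<zeta> \<in> param_space 1 1 1" "M = cone_of \<zeta>"
      using \<open>M \<in> classification_fan 1 1 1 three_points\<close> by (auto simp: classification_fan_iff)
    then show ?thesis
      using adjacent_to_positive_err[of ?\<theta> \<zeta>] \<open>adjacent 1 1 1 ?K M\<close>
      by (simp add: err_cone val del: One_nat_def)
  qed
  have isolated: "\<not> adjacent 1 1 1 ?K M" if "M \<in> ?sub" for M
    using nbr[of M] that by (auto simp: sublevel_set_def level_set_def simp del: One_nat_def)
  have lev_sub: "?lev \<subseteq> ?sub" by (auto simp: sublevel_set_def)
  have "?K \<noteq> ?L"
  proof
    assume "?K = ?L"
    then have "pattern ?\<theta> = pattern ?\<eta>" using mem by (intro activation_cone_inject)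
    moreover have "(pt 0, 0) \<in> pattern ?\<theta>" "(pt 0, 0) \<notin> pattern ?\<eta>"
      unfolding mem_pattern val by (auto simp: three_points_def)
    ultimately show False by simp
  qed
  then have "\<not> strongly_connected 1 1 1 ?sub"
    using isolated_cone_path[of ?sub 1 1 1 ?K ?L] isolated lev lev_sub full
    unfolding strongly_connected_def by blast
  moreover have "{?K} \<in> strong_components 1 1 1 ?lev"
    using lev(1) full(1) isolated lev_sub by (intro isolated_cone_component) auto
  moreover have "\<forall>M\<in>neighbors 1 1 1 three_points {?K}.
      err_cone 1 1 1 three_points alternating M > 1"
    using nbr by (auto simp: neighbors_def simp del: One_nat_def)
  ultimately show ?thesis
    using D gp dich by (intro exI[of _ 1] exI[of _ three_points] exI[of _ alternating]) blast
qed

end
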